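(* Let $\mathbb{D}\subset\mathbb{C}$, admissible quadruples, the matrices $X_6(x,y,u,v)$, and the matrices $C_6$, $D_6$ be as defined in the context. (a) The six points of $\mathbb{D}$ which are farthest from the center $0$ (the maximal extremal points) are $$\alpha^{max}_k=\sqrt{-9+6\sqrt{3}}\;e^{\mathbf{i}\left(\frac{\pi}{6}+k\frac{\pi}{3}\right)},\qquad k=1,2,\dots,6,$$ and for each of them the matrices $X_6(x,y,u,v)$ with $(x,y,u,v)$ admissible for $\alpha^{max}_k$ are equivalent to $C_6$. (b) The six points of the boundary of $\mathbb{D}$ which are closest to the center $0$ (the minimal extremal points) are $$\alpha^{min}_k=e^{\mathbf{i}k\frac{\pi}{3}},\qquad k=1,2,\dots,6,$$ and for each of them the matrices $X_6(x,y,u,v)$ with $(x,y,u,v)$ admissible for $\alpha^{min}_k$ are equivalent to $D_6$.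
   Context: $\mathbb{T}=\{z\in\mathbb{C}:|z|=1\}$. A complex Hadamard matrix of order $n$ is an $n\times n$ matrix $H$ with all entries in $\mathbb{T}$ and $HH^\ast=nI_n$. Two complex Hadamard matrices $H,K$ are equivalent if $H=D_1PKQD_2$ for some unitary diagonal matrices $D_1,D_2$ and permutation matrices $P,Q$. Let $\varphi:\mathbb{T}\times\mathbb{T}\to\mathbb{C}$, $\varphi[x,y]=x+y+\frac{1}{xy}$, and $\mathbb{D}=\mathrm{ran}(\varphi)\cap\mathrm{ran}(-\varphi)\subset\mathbb{C}$. For $\alpha\in\mathbb{C}$ let $f_\alpha(x)=x^3-\alpha x^2+\overline{\alpha}x-1$. For $\alpha\in\mathbb{D}$ let $r_1,r_2,r_3$ be the roots of $f_\alpha$ and $q_1,q_2,q_3$ the roots of $f_{-\alpha}$, both listed with multiplicity. A quadruple $(x,y,u,v)$ is admissible for $\alpha$ if $(x,y)=(r_i,r_j)$ and $(u,v)=(q_k,q_l)$ for some $i\neq j$, $k\neq l$. Put $$X_6(x,y,u,v)=\begin{bmatrix} 1 & 1 & 1 & 1 & 1 & 1 \\ 1 & x^2 y & x y^2 & \frac{x y}{u v} & u x y & v x y \\ 1 & \frac{x}{y} & x^2 y & \frac{x}{u} & \frac{x}{v} & u v x \\ 1 & u v x & u x y & -1 & -u x y & -u v x \\ 1 & \frac{x}{u} & v x y & -\frac{x}{u} & -1 & -v x y \\ 1 & \frac{x}{v} & \frac{x y}{u v} & -\frac{x y}{u v} & -\frac{x}{v} & -1 \end{bmatrix}.$$ $C_6$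 (Björck's cyclic matrix) is, up to equivalence, the $6\times6$ circulant matrix with first row $\left(1,\ \mathbf{i}/d,\ -1/d,\ -\mathbf{i},\ -d,\ \mathbf{i}d\right)$, where $d=\frac{1-\sqrt3}{2}+\mathbf{i}\sqrt{\frac{\sqrt3}{2}}$. $D_6$ is, up to equivalence, the matrix $$\begin{bmatrix} 1 & 1 & 1 & 1 & 1 & 1 \\ 1 & -1 & -\mathbf{i} & \mathbf{i} & -\mathbf{i} & \mathbf{i} \\ 1 & -\mathbf{i} & -1 & -\mathbf{i} & \mathbf{i} & \mathbf{i} \\ 1 & \mathbf{i} & -\mathbf{i} & -1 & \mathbf{i} & -\mathbf{i} \\ 1 & -\mathbf{i} & \mathbf{i} & \mathbf{i} & -1 & -\mathbf{i} \\ 1 & \mathbf{i} & \mathbf{i} & -\mathbf{i} & -\mathbf{i} & -1 \end{bmatrix}.$$ *)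

theory Defs
  imports "HOL-Analysis.Analysis" "HOL-Computational_Algebra.Polynomial"
begin

abbreviation unit_circle :: "complex set" ("\<T>")
  where "\<T> \<equiv> sphere 0 1"

definition conj_transpose :: "complex^'n^'m \<Rightarrow> complex^'m^'n"
  where "conj_transpose A = (\<chi> i j. cnj (A $ j $ i))"

definition complex_hadamard :: "complex^'n^'n \<Rightarrow> bool"
  where "complex_hadamard H \<longleftrightarrow>
    (\<forall>i j. H $ i $ j \<in> \<T>) \<and> H ** conj_transpose H = mat (of_nat CARD('n))"

definition unitary_diagonal :: "complex^'n^'n \<Rightarrow> bool"
  where "unitary_diagonal D \<longleftrightarrow>
    (\<forall>i j. i \<noteq> j \<longrightarrow> D $ i $ j = 0) \<and>
    D ** conj_transpose D = mat 1 \<and> conj_transpose D ** D = mat 1"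

definition permutation_matrix :: "complex^'n^'n \<Rightarrow> bool"
  where "permutation_matrix P \<longleftrightarrow>
    (\<exists>\<pi>. \<pi> permutes UNIV \<and> P = (\<chi> i j. if j = \<pi> i then 1 else 0))"

text \<open>Equivalence is a relation between complex Hadamard matrices, so it includes the
  assertion that both arguments are complex Hadamard.\<close>

definition hadamard_equiv :: "complex^'n^'n \<Rightarrow> complex^'n^'n \<Rightarrow> bool"
  where "hadamard_equiv H K \<longleftrightarrow>
    complex_hadamard H \<and> complex_hadamard K \<and>
    (\<exists>D1 P Q D2. unitary_diagonal D1 \<and> unitary_diagonal D2 \<and>
       permutation_matrix P \<and> permutation_matrix Q \<and>
       H = D1 ** P ** K ** Q ** D2)"

definition phi :: "complex \<Rightarrow> complex \<Rightarrow> complex"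
  where "phi x y = x + y + 1 / (x * y)"

definition region_D :: "complex set" ("\<D>")
  where "\<D> = {phi x y |x y. x \<in> \<T> \<and> y \<in> \<T>} \<inter> {- phi x y |x y. x \<in> \<T> \<and> y \<in> \<T>}"

definition f_poly :: "complex \<Rightarrow> complex poly"
  where "f_poly \<alpha> = [:- 1, cnj \<alpha>, - \<alpha>, 1:]"

text \<open>The lists \<open>r\<close> and \<open>q\<close> enumerate the roots with multiplicity; they have length 3 since
  the polynomials are cubic.  The indices are required to differ, not the root values.\<close>

definition admissible ::
    "complex \<Rightarrow> complex \<Rightarrow> complex \<Rightarrow> complex \<Rightarrow> complex \<Rightarrow> bool"
  where "admissible \<alpha> x y u v \<longleftrightarrow>
    (\<exists>r q. mset r = proots (f_poly \<alpha>) \<and> mset q = proots (f_poly (- \<alpha>)) \<and>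
       (\<exists>i<3. \<exists>j<3. i \<noteq> j \<and> x = r ! i \<and> y = r ! j) \<and>
       (\<exists>k<3. \<exists>l<3. k \<noteq> l \<and> u = q ! k \<and> v = q ! l))"

definition X6 :: "complex \<Rightarrow> complex \<Rightarrow> complex \<Rightarrow> complex \<Rightarrow> complex^6^6"
  where "X6 x y u v = vector
    [vector [1, 1, 1, 1, 1, 1],
     vector [1, x^2 * y, x * y^2, (x * y) / (u * v), u * x * y, v * x * y],
     vector [1, x / y, x^2 * y, x / u, x / v, u * v * x],
     vector [1, u * v * x, u * x * y, - 1, - (u * x * y), - (u * v * x)],
     vector [1, x / u, v * x * y, - (x / u), - 1, - (v * x * y)],
     vector [1, x / v, (x * y) / (u * v), - ((x * y) / (u * v)), - (x / v), - 1]]"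

text \<open>Arithmetic in the index type \<open>6\<close> is modulo 6 and the entries of \<open>vector\<close> are numbered
  from 1, so \<open>c $ 1\<close> is on the diagonal and each row is the preceding one shifted cyclically
  to the right.\<close>

definition circulant :: "complex^6 \<Rightarrow> complex^6^6"
  where "circulant c = (\<chi> i j. c $ (j - i + 1))"

definition C6 :: "complex^6^6"
  where "C6 =
    (let d = of_real ((1 - sqrt 3) / 2) + \<i> * of_real (sqrt (sqrt 3 / 2))
     in circulant (vector [1, \<i> / d, - 1 / d, - \<i>, - d, \<i> * d]))"

definition D6 :: "complex^6^6"
  where "D6 = vector
    [vector [1, 1, 1, 1, 1, 1],
     vector [1, - 1, - \<i>, \<i>, - \<i>, \<i>],
     vector [1, - \<i>, - 1, - \<i>, \<i>, \<i>],
     vector [1, \<i>, - \<i>, - 1, \<i>, - \<i>],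
     vector [1, - \<i>, \<i>, \<i>, - 1, - \<i>],
     vector [1, \<i>, \<i>, - \<i>, - \<i>, - 1]]"

definition alpha_max :: "nat \<Rightarrow> complex"
  where "alpha_max k =
    of_real (sqrt (- 9 + 6 * sqrt 3)) * exp (\<i> * of_real (pi / 6 + real k * (pi / 3)))"

definition alpha_min :: "nat \<Rightarrow> complex"
  where "alpha_min k = exp (\<i> * of_real (real k * (pi / 3)))"

end

theory Submission
  imports Defs "HOL-Computational_Algebra.Fundamental_Theorem_Algebra"
begin

text \<open>Every complex number can be written as \<open>\<alpha> = m w + w\<^sup>-\<^sup>2\<close> with \<open>m\<close> real and \<open>w\<close> on the unit circle,
  and the discriminant of \<open>f_\<alpha>\<close> is then \<open>(m\<^sup>2 - 4) (m - 2 Re w\<^sup>3)\<^sup>2\<close>. The range of \<open>\<phi>\<close> corresponds to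
  \<open>\<bar>m\<bar> \<le> 2\<close>, hence to the \<open>\<alpha>\<close> of discriminant at most \<open>0\<close>, and \<open>\<D>\<close> is the set where the discriminants
  of \<open>f_\<alpha>\<close> and \<open>f_{-\<alpha>}\<close> are both at most \<open>0\<close>. The two differ only in the sign of \<open>8 Re \<alpha>\<^sup>3\<close>: adding
  them bounds \<open>\<bar>\<alpha>\<bar>\<close> on \<open>\<D>\<close>, while the larger one is at most \<open>(\<bar>\<alpha>\<bar> - 1) (\<bar>\<alpha>\<bar> + 3)\<^sup>3\<close>, with equality
  when \<open>\<alpha>\<^sup>3\<close> is real, which locates the frontier points of smallest modulus.

  Multiplying \<open>\<alpha>\<close> by a cube root of unity \<open>\<omega>\<close> multiplies all the roots by \<open>\<omega>\<close> and does not change \<open>X\<^sub>6\<close>,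
  so in each of the two orbits only a pair \<open>\<plusminus>\<alpha>\<close> matters. At these points the roots are up to
  sign powers of \<open>d\<close>, respectively powers of \<open>\<i>\<close>, and a cyclic symmetry of \<open>X\<^sub>6\<close> in the roots of
  \<open>f_{-\<alpha>}\<close> leaves six matrices to be compared with \<open>C\<^sub>6\<close> and twelve with \<open>D\<^sub>6\<close>.\<close>

section \<open>Monomial equivalence\<close>

lemma exhaust_6:
  fixes i :: 6
  shows "i = 1 \<or> i = 2 \<or> i = 3 \<or> i = 4 \<or> i = 5 \<or> i = 6"
proof (induct i)
  case (of_int z)
  then have "z = 0 \<or> z = 1 \<or> z = 2 \<or> z = 3 \<or> z = 4 \<or> z = 5"
    by fastforce
  then show ?case by auto
qed

lemma forall_6: "(\<forall>i::6. P i) \<longleftrightarrow> P 1 \<and> P 2 \<and> P 3 \<and> P 4 \<and> P 5 \<and> P 6"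
  by (metis exhaust_6)

lemma distinct_6:
  "(1::6) \<noteq> 2" "(1::6) \<noteq> 3" "(1::6) \<noteq> 4" "(1::6) \<noteq> 5" "(1::6) \<noteq> 6"
  "(2::6) \<noteq> 3" "(2::6) \<noteq> 4" "(2::6) \<noteq> 5" "(2::6) \<noteq> 6"
  "(3::6) \<noteq> 4" "(3::6) \<noteq> 5" "(3::6) \<noteq> 6"
  "(4::6) \<noteq> 5" "(4::6) \<noteq> 6" "(5::6) \<noteq> 6"
  by (simp_all add: eq_numeral_iff_iszero)

lemma UNIV_6: "(UNIV :: 6 set) = {1, 2, 3, 4, 5, 6}"
  using exhaust_6 by auto

lemma sum_6: "sum f (UNIV :: 6 set) = f 1 + f 2 + f 3 + f 4 + f 5 + f 6"
  by (simp only: UNIV_6 sum.insert finite_insert finite.emptyI insert_iff empty_iff distinct_6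
      simp_thms sum.empty add.assoc add_0_right)

lemma vector_6:
  fixes a b c d e f :: "'a::zero"
  shows "(vector [a, b, c, d, e, f] :: 'a^6) $ 1 = a"
    "(vector [a, b, c, d, e, f] :: 'a^6) $ 2 = b"
    "(vector [a, b, c, d, e, f] :: 'a^6) $ 3 = c"
    "(vector [a, b, c, d, e, f] :: 'a^6) $ 4 = d"
    "(vector [a, b, c, d, e, f] :: 'a^6) $ 5 = e"
    "(vector [a, b, c, d, e, f] :: 'a^6) $ 6 = f"
  unfolding vector_def by (simp_all add: distinct_6 distinct_6[symmetric])

text \<open>On and below the subdiagonal of \<open>circulant\<close> the index
  \<open>j - i + 1\<close> evaluates to \<open>0, - 1, ..., - 4\<close>, which modulo 6 are the
  positions 6 down to 2.\<close>

lemma vector_6_residues: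
  fixes a b c d e f :: "'a::zero"
  shows "(vector [a, b, c, d, e, f] :: 'a^6) $ 0 = f"
    "(vector [a, b, c, d, e, f] :: 'a^6) $ (- 1) = e"
    "(vector [a, b, c, d, e, f] :: 'a^6) $ (- 2) = d"
    "(vector [a, b, c, d, e, f] :: 'a^6) $ (- 3) = c"
    "(vector [a, b, c, d, e, f] :: 'a^6) $ (- 4) = b"
proof -
  have residues: "(0::6) = 6" "(- 1 :: 6) = 5" "(- 2 :: 6) = 4" "(- 3 :: 6) = 3" "(- 4 :: 6) = 2"
    by simp_all
  show "(vector [a, b, c, d, e, f] :: 'a^6) $ 0 = f"
    "(vector [a, b, c, d, e, f] :: 'a^6) $ (- 1) = e"
    "(vector [a, b, c, d, e, f] :: 'a^6) $ (- 2) = d"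
    "(vector [a, b, c, d, e, f] :: 'a^6) $ (- 3) = c"
    "(vector [a, b, c, d, e, f] :: 'a^6) $ (- 4) = b"
    unfolding residues by (rule vector_6)+
qed

lemma unit_circle_mult_cnj: "z \<in> \<T> \<Longrightarrow> z * cnj z = 1"
  by (simp add: complex_norm_square[symmetric])

section \<open>Diagonal and permutation matrices, and equivalence entry by entry\<close>

definition diag :: "('n \<Rightarrow> complex) \<Rightarrow> complex^'n^'n"
  where "diag a = (\<chi> i j. if i = j then a i else 0)"

definition perm_mat :: "('n \<Rightarrow> 'n) \<Rightarrow> complex^'n^'n"
  where "perm_mat p = (\<chi> i j. if j = p i then 1 else 0)"

lemma diag_mult: "(diag a ** A) $ i $ j = a i * A $ i $ j"
  by (simp add: diag_def matrix_matrix_mult_def if_distrib[of "\<lambda>x. x * _"] cong: if_cong)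

lemma mult_diag: "(A ** diag a) $ i $ j = A $ i $ j * a j"
  by (simp add: diag_def matrix_matrix_mult_def if_distrib[of "\<lambda>x. _ * x"] cong: if_cong)

lemma perm_mat_mult: "(perm_mat p ** A) $ i $ j = A $ p i $ j"
  by (simp add: perm_mat_def matrix_matrix_mult_def if_distrib[of "\<lambda>x. x * _"] cong: if_cong)

text \<open>Row \<open>k\<close> of \<open>perm_mat p\<close> has its one in column
  \<open>p k\<close>, so column \<open>j\<close> of the product is column \<open>inv p j\<close> of
  \<open>A\<close>.\<close>

lemma mult_perm_mat:
  assumes "p permutes UNIV"
  shows "(A ** perm_mat p) $ i $ j = A $ i $ inv p j"
proof -
  have "j = p k \<longleftrightarrow> k = inv p j" for k
    using assms by (metis permutes_inverses)
  then show ?thesis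
    by (simp add: perm_mat_def matrix_matrix_mult_def if_distrib[of "\<lambda>x. _ * x"] cong: if_cong)
qed

lemma monomial_mult:
  assumes "s permutes UNIV"
  shows "(diag a ** perm_mat p ** K ** perm_mat s ** diag b) $ i $ j = a i * K $ p i $ inv s j * b j"
  by (simp only: mult_diag mult_perm_mat[OF assms])
    (simp only: diag_mult perm_mat_mult flip: matrix_mul_assoc)

lemma conj_transpose_diag: "conj_transpose (diag a) = diag (\<lambda>i. cnj (a i))"
  by (simp add: conj_transpose_def diag_def vec_eq_iff)

lemma unitary_diagonal_iff: "unitary_diagonal D \<longleftrightarrow> (\<exists>a. (\<forall>i. a i \<in> \<T>) \<and> D = diag a)"
proof
  assume D: "unitary_diagonal D"
  define a where "a i = D $ i $ i" for i
  have diag: "D = diag a"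
    using D by (auto simp: unitary_diagonal_def vec_eq_iff diag_def a_def)
  have "a i \<in> \<T>" for i
  proof -
    have "(diag a ** conj_transpose (diag a)) $ i $ i = 1"
      using D by (simp add: unitary_diagonal_def mat_def diag)
    then have "a i * cnj (a i) = 1"
      unfolding conj_transpose_diag diag_mult by (simp add: diag_def)
    then have "(cmod (a i))\<^sup>2 = 1"
      by (metis complex_norm_square of_real_eq_1_iff)
    then show ?thesis
      using norm_ge_zero[of "a i"] by (auto simp: power2_eq_1_iff simp del: norm_ge_zero)
  qed
  with diag show "\<exists>a. (\<forall>i. a i \<in> \<T>) \<and> D = diag a"
    by blast
next
  assume "\<exists>a. (\<forall>i. a i \<in> \<T>) \<and> D = diag a"
  then obtain a where a: "\<forall>i. a i \<in> \<T>" and D: "D = diag a"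
    by auto
  have "diag a ** diag (\<lambda>i. cnj (a i)) = mat 1" "diag (\<lambda>i. cnj (a i)) ** diag a = mat 1"
    using unit_circle_mult_cnj[OF a[rule_format]]
    unfolding vec_eq_iff diag_mult by (simp_all add: diag_def mat_def mult.commute[of "cnj _"])
  then show "unitary_diagonal D"
    unfolding unitary_diagonal_def D conj_transpose_diag by (simp add: diag_def)
qed

lemma permutation_matrix_iff: "permutation_matrix P \<longleftrightarrow> (\<exists>p. p permutes UNIV \<and> P = perm_mat p)"
  by (simp add: permutation_matrix_def perm_mat_def)

text \<open>The Hadamard property travels from \<open>K\<close> to \<open>H\<close>: the column
  phases cancel against their conjugates, and the column permutation merely reindexes the inner
  product of two rows. On a finite index type injectivity already gives a permutation, and it is
  easy to check for explicit lists.\<close>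

lemma hadamard_equiv_iff:
  fixes H K :: "complex^'n^'n"
  shows "hadamard_equiv H K \<longleftrightarrow> complex_hadamard K \<and>
    (\<exists>a b p s. (\<forall>i. a i \<in> \<T>) \<and> (\<forall>i. b i \<in> \<T>) \<and> inj p \<and> inj s \<and>
       (\<forall>i j. H $ i $ j = a i * K $ p i $ s j * b j))"
proof
  assume "hadamard_equiv H K"
  then obtain a b p s where K: "complex_hadamard K"
    and ab: "\<forall>i. a i \<in> \<T>" "\<forall>i. b i \<in> \<T>"
    and ps: "p permutes UNIV" "s permutes UNIV"
    and H: "H = diag a ** perm_mat p ** K ** perm_mat s ** diag b"
    unfolding hadamard_equiv_def unitary_diagonal_iff permutation_matrix_iff by blast
  have "H $ i $ j = a i * K $ p i $ inv s j * b j" for i j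
    unfolding H by (rule monomial_mult) fact
  moreover have "inj p" "inj (inv s)"
    using ps permutes_inj permutes_inv by blast+
  ultimately show "complex_hadamard K \<and>
    (\<exists>a b p s. (\<forall>i. a i \<in> \<T>) \<and> (\<forall>i. b i \<in> \<T>) \<and> inj p \<and> inj s \<and>
       (\<forall>i j. H $ i $ j = a i * K $ p i $ s j * b j))"
    using K ab by blast
next
  assume "complex_hadamard K \<and>
    (\<exists>a b p s. (\<forall>i. a i \<in> \<T>) \<and> (\<forall>i. b i \<in> \<T>) \<and> inj p \<and> inj s \<and>
       (\<forall>i j. H $ i $ j = a i * K $ p i $ s j * b j))"
  then obtain a b p s where K: "complex_hadamard K"
    and ab: "\<forall>i. a i \<in> \<T>" "\<forall>i. b i \<in> \<T>" and ps: "inj p" "inj s"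
    and H: "\<And>i j. H $ i $ j = a i * K $ p i $ s j * b j"
    by auto
  have a: "a i \<in> \<T>" and b: "b i \<in> \<T>" for i
    using ab by auto
  have perm: "p permutes UNIV" "s permutes UNIV"
    using ps by (auto intro!: bij_imp_permutes simp: bij_def finite_UNIV_inj_surj)
  have "(H ** conj_transpose H) $ i $ j = mat (of_nat CARD('n)) $ i $ j" for i j
  proof -
    have "(H ** conj_transpose H) $ i $ j
        = (\<Sum>k\<in>UNIV. a i * cnj (a j) * (K $ p i $ s k * cnj (K $ p j $ s k)))"
    proof -
      have "H $ i $ k * cnj (H $ j $ k)
          = (b k * cnj (b k)) * (a i * cnj (a j) * (K $ p i $ s k * cnj (K $ p j $ s k)))" for k
        unfolding H by (simp add: mult_ac)
      then show ?thesis
        unfolding unit_circle_mult_cnj[OF b] by (simp add: matrix_matrix_mult_def conj_transpose_def)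
    qed
    also have "\<dots> = a i * cnj (a j) * (\<Sum>k\<in>UNIV. K $ p i $ k * cnj (K $ p j $ k))"
      using sum.permute[OF perm(2), of "\<lambda>k. K $ p i $ k * cnj (K $ p j $ k)"]
      by (simp add: sum_distrib_left o_def)
    also have "(\<Sum>k\<in>UNIV. K $ p i $ k * cnj (K $ p j $ k)) = (K ** conj_transpose K) $ p i $ p j"
      by (simp add: matrix_matrix_mult_def conj_transpose_def)
    also have "\<dots> = mat (of_nat CARD('n)) $ p i $ p j"
      using K by (simp add: complex_hadamard_def)
    finally show ?thesis
      using ps(1) unit_circle_mult_cnj[OF a] by (auto simp: mat_def inj_eq)
  qed
  moreover have "H $ i $ j \<in> \<T>" for i j
    using a b K by (simp add: H complex_hadamard_def norm_mult)
  ultimately have "complex_hadamard H"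
    by (simp add: complex_hadamard_def vec_eq_iff)
  moreover have inv_s: "inv s permutes UNIV"
    using perm(2) by (rule permutes_inv)
  have "H = diag a ** perm_mat p ** K ** perm_mat (inv s) ** diag b"
    by (simp add: vec_eq_iff H monomial_mult[OF inv_s] permutes_inv_inv[OF perm(2)])
  ultimately show "hadamard_equiv H K"
    using K ab perm(1) inv_s
    unfolding hadamard_equiv_def unitary_diagonal_iff permutation_matrix_iff by blast
qed

lemma hadamard_equiv_reindex:
  assumes "hadamard_equiv H' K" "inj p" "inj s" "\<And>i j. H $ i $ j = H' $ p i $ s j"
  shows "hadamard_equiv H K"
proof -
  obtain a b p' s' where "complex_hadamard K" "\<forall>i. a i \<in> \<T>" "\<forall>i. b i \<in> \<T>" "inj p'" "inj s'"
    "\<forall>i j. H' $ i $ j = a i * K $ p' i $ s' j * b j"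
    using assms(1) unfolding hadamard_equiv_iff by blast
  then show ?thesis
    using assms(2-) unfolding hadamard_equiv_iff
    by (intro conjI exI[of _ "a \<circ> p"] exI[of _ "b \<circ> s"] exI[of _ "p' \<circ> p"] exI[of _ "s' \<circ> s"])
      (simp_all add: inj_compose)
qed

text \<open>Normalizing row \<open>r\<close> and column \<open>c\<close> determines the two diagonal matrices, so only the
  permutations have to be supplied.\<close>

lemma hadamard_equivI:
  assumes K: "complex_hadamard K" and ps: "inj p" "inj s"
    and H: "\<And>i j. H $ i $ j * (K $ p i $ s c * K $ p r $ s j) = K $ p i $ s j * K $ p r $ s c"
  shows "hadamard_equiv H K"
proof -
  have norm: "cmod (K $ i $ j) = 1" for i j
    using K by (simp add: complex_hadamard_def)
  then have nz: "K $ i $ j \<noteq> 0" for i j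
    by (metis norm_zero zero_neq_one)
  define a where "a i = K $ p r $ s c / K $ p i $ s c" for i
  define b where "b j = 1 / K $ p r $ s j" for j
  have "\<forall>i. a i \<in> \<T>" "\<forall>i. b i \<in> \<T>"
    by (auto simp: a_def b_def norm norm_divide)
  moreover have "H $ i $ j = a i * K $ p i $ s j * b j" for i j
    using H[of i j] nz by (simp add: a_def b_def nonzero_eq_divide_eq mult_ac)
  ultimately show ?thesis
    unfolding hadamard_equiv_iff
    by (intro conjI exI[of _ a] exI[of _ b] exI[of _ p] exI[of _ s]) (simp_all add: K ps)
qed

section \<open>The matrices \<open>X6\<close>, \<open>C6\<close> and \<open>D6\<close>\<close>

lemma inj_vector_6:
  assumes "distinct [a, b, c, d, e, f]"
  shows "inj (($) (vector [a, b, c, d, e, f] :: 'a::zero^6))"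
  unfolding inj_def forall_6 using assms by (auto simp: vector_6 distinct_6)

text \<open>The pivot is the first row and column, where \<open>X6\<close> is constantly 1. Each
  permutation is given by its six images, and the hypothesis compares \<open>X6\<close> with the
  dephased \<open>K\<close> after clearing the denominators on the side of \<open>K\<close>.\<close>

lemma X6_equivI:
  assumes K: "complex_hadamard K"
    and ps: "distinct [p1, p2, p3, p4, p5, p6]" "distinct [s1, s2, s3, s4, s5, s6]"
    and H: "\<forall>i j. X6 x y u v $ i $ j
        * (K $ (vector [p1, p2, p3, p4, p5, p6] $ i) $ s1 * K $ p1 $ (vector [s1, s2, s3, s4, s5, s6] $ j))
      = K $ (vector [p1, p2, p3, p4, p5, p6] $ i) $ (vector [s1, s2, s3, s4, s5, s6] $ j) * K $ p1 $ s1"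
  shows "hadamard_equiv (X6 x y u v) K"
  using H by (intro hadamard_equivI[OF K inj_vector_6[OF ps(1)] inj_vector_6[OF ps(2)], where r = 1 and c = 1])
    (simp add: vector_6)

text \<open>A cyclic shift of the three roots \<open>u\<close>, \<open>v\<close>,
  \<open>w = 1 / (u * v)\<close> only permutes rows 4, 5, 6 and columns 4, 5, 6 by the same
  3-cycle.\<close>

lemma X6_rotate:
  assumes "u * v * w = 1" "hadamard_equiv (X6 x y v w) K"
  shows "hadamard_equiv (X6 x y u v) K"
proof (rule hadamard_equiv_reindex[OF assms(2)])
  let ?p = "($) (vector [1, 2, 3, 6, 4, 5] :: 6^6)"
  show "inj ?p" "inj ?p"
    by (rule inj_vector_6; simp add: distinct_6 distinct_6[symmetric])+
  have nz: "u \<noteq> 0" "v \<noteq> 0"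
    using assms(1) by auto
  then have w: "w = 1 / (u * v)"
    using assms(1) by (simp add: field_simps)
  have "\<forall>i j. X6 x y u v $ i $ j = X6 x y v w $ ?p i $ ?p j"
    using nz unfolding forall_6 w by (simp add: X6_def vector_6 field_simps)
  then show "X6 x y u v $ i $ j = X6 x y v w $ ?p i $ ?p j" for i j
    by blast
qed

text \<open>Every entry is homogeneous of degree 0 or 3 in the four roots.\<close>

lemma X6_scale:
  assumes "\<omega> ^ 3 = 1"
  shows "X6 (\<omega> * x) (\<omega> * y) (\<omega> * u) (\<omega> * v) = X6 x y u v"
proof -
  have \<omega>: "\<omega> \<noteq> 0" "\<omega> * (\<omega> * \<omega>) = 1" "\<omega> * (\<omega> * (\<omega> * t)) = t" for t
    using assms by (auto simp: power3_eq_cube mult.assoc[symmetric])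
  show ?thesis
    using \<omega>(1) by (simp add: X6_def power2_eq_square mult_ac \<omega>(2,3))
qed

section \<open>The constant of the cyclic matrix, and explicit equivalences\<close>

definition d6 :: complex
  where "d6 = of_real ((1 - sqrt 3) / 2) + \<i> * of_real (sqrt (sqrt 3 / 2))"

lemma norm_d6: "cmod d6 = 1"
proof -
  have "(cmod d6)\<^sup>2 = ((1 - sqrt 3) / 2)\<^sup>2 + (sqrt (sqrt 3 / 2))\<^sup>2"
    by (simp add: d6_def cmod_power2)
  also have "\<dots> = 1"
    by (simp add: power2_eq_square field_simps)
  finally show ?thesis
    by (simp add: power2_eq_1_iff) (smt (verit) norm_ge_zero)
qed

lemma d6_cnj: "d6 * cnj d6 = 1" "d6 * (cnj d6 * t) = t"
  using norm_d6 unit_circle_mult_cnj[of d6] by (simp_all flip: mult.assoc)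

lemma d6_nonzero: "d6 \<noteq> 0"
  using norm_d6 by auto

lemma inverse_d6: "inverse d6 = cnj d6"
  using d6_cnj(1) by (rule inverse_unique)

text \<open>For \<open>s = d6 + cnj d6 = 1 - sqrt 3\<close> this is
  \<open>s * s = 2 * s + 2\<close>, rearranged by \<open>d6 * cnj d6 = 1\<close>. As a rewrite rule
  it removes squares of \<open>cnj d6\<close>, which decides the orthogonality of the rows of
  \<open>C6\<close>.\<close>

lemma d6_quadratic: "cnj d6 * cnj d6 = 2 * d6 + 2 * cnj d6 - d6 * d6"
  by (simp add: complex_eq_iff d6_def) (simp add: field_simps)

lemma divide_d6: "t / d6 = t * cnj d6"
  by (simp add: divide_inverse inverse_d6)

lemma C6_eq: "C6 = circulant (vector [1, \<i> * cnj d6, - cnj d6, - \<i>, - d6, \<i> * d6])"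
  unfolding C6_def Let_def d6_def[symmetric] divide_d6 by simp

lemma C6_nth:
  "C6 = vector [
    vector [1, \<i> * cnj d6, - cnj d6, - \<i>, - d6, \<i> * d6],
    vector [\<i> * d6, 1, \<i> * cnj d6, - cnj d6, - \<i>, - d6],
    vector [- d6, \<i> * d6, 1, \<i> * cnj d6, - cnj d6, - \<i>],
    vector [- \<i>, - d6, \<i> * d6, 1, \<i> * cnj d6, - cnj d6],
    vector [- cnj d6, - \<i>, - d6, \<i> * d6, 1, \<i> * cnj d6],
    vector [\<i> * cnj d6, - cnj d6, - \<i>, - d6, \<i> * d6, 1]]"
  unfolding C6_eq vec_eq_iff forall_6
  by (simp add: circulant_def vector_6 vector_6_residues)

lemma complex_hadamard_C6: "complex_hadamard C6"
  unfolding complex_hadamard_def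
proof
  show "\<forall>i j. C6 $ i $ j \<in> \<T>"
    unfolding forall_6 C6_nth by (simp add: vector_6 norm_d6 norm_mult)
  show "C6 ** conj_transpose C6 = mat (of_nat CARD(6))"
    unfolding vec_eq_iff forall_6 matrix_matrix_mult_def conj_transpose_def sum_6 mat_def C6_nth
    by (simp add: vector_6 distinct_6 distinct_6[symmetric] algebra_simps d6_cnj d6_quadratic)
qed

lemma complex_hadamard_D6: "complex_hadamard D6"
  unfolding complex_hadamard_def
proof
  show "\<forall>i j. D6 $ i $ j \<in> \<T>"
    unfolding forall_6 D6_def by (simp add: vector_6)
  show "D6 ** conj_transpose D6 = mat (of_nat CARD(6))"
    unfolding vec_eq_iff forall_6 matrix_matrix_mult_def conj_transpose_def sum_6 mat_def D6_def
    by (simp add: vector_6 distinct_6 distinct_6[symmetric])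
qed

lemma inverse_cnj_d6: "inverse (cnj d6) = d6"
  using d6_cnj(1) by (intro inverse_unique) (simp add: mult.commute)

lemmas X6_C6_simps = forall_6 X6_def vector_6 distinct_6 C6_nth d6_cnj d6_nonzero divide_inverse
  power2_eq_square inverse_d6 inverse_cnj_d6 mult_ac

text \<open>The permutations of rows and columns, listed as six images each, were found by an exhaustive
  search.\<close>

lemma X6_equiv_C6:
  "hadamard_equiv (X6 (- cnj d6) (- cnj d6) ((cnj d6)\<^sup>2) (- d6)) C6"
  "hadamard_equiv (X6 (- cnj d6) (d6\<^sup>2) ((cnj d6)\<^sup>2) (- d6)) C6"
  "hadamard_equiv (X6 (d6\<^sup>2) (- cnj d6) ((cnj d6)\<^sup>2) (- d6)) C6"
  "hadamard_equiv (X6 (- d6) (- d6) (d6\<^sup>2) (- cnj d6)) C6"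
  "hadamard_equiv (X6 (- d6) ((cnj d6)\<^sup>2) (d6\<^sup>2) (- cnj d6)) C6"
  "hadamard_equiv (X6 ((cnj d6)\<^sup>2) (- d6) (d6\<^sup>2) (- cnj d6)) C6"
proof -
  \<comment> \<open>In all six cases both sides of each entry identity are signed monomials in \<i>,
    \<open>d6\<close> and \<open>cnj d6\<close>, so cancelling \<open>d6 * cnj d6\<close> settles
    them.\<close>
  show "hadamard_equiv (X6 (- cnj d6) (- cnj d6) ((cnj d6)\<^sup>2) (- d6)) C6"
    by (rule X6_equivI[OF complex_hadamard_C6, of 1 3 5 4 6 2 2 4 6 3 5 1])
      (simp_all add: X6_C6_simps)
  show "hadamard_equiv (X6 (- cnj d6) (d6\<^sup>2) ((cnj d6)\<^sup>2) (- d6)) C6"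
    by (rule X6_equivI[OF complex_hadamard_C6, of 1 5 3 2 6 4 1 5 3 2 6 4])
      (simp_all add: X6_C6_simps)
  show "hadamard_equiv (X6 (d6\<^sup>2) (- cnj d6) ((cnj d6)\<^sup>2) (- d6)) C6"
    by (rule X6_equivI[OF complex_hadamard_C6, of 1 5 3 6 4 2 5 3 1 2 6 4])
      (simp_all add: X6_C6_simps)
  show "hadamard_equiv (X6 (- d6) (- d6) (d6\<^sup>2) (- cnj d6)) C6"
    by (rule X6_equivI[OF complex_hadamard_C6, of 1 3 5 4 6 2 5 1 3 6 2 4])
      (simp_all add: X6_C6_simps)
  show "hadamard_equiv (X6 (- d6) ((cnj d6)\<^sup>2) (d6\<^sup>2) (- cnj d6)) C6"
    by (rule X6_equivI[OF complex_hadamard_C6, of 1 3 5 6 2 4 1 3 5 6 2 4])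
      (simp_all add: X6_C6_simps)
  show "hadamard_equiv (X6 ((cnj d6)\<^sup>2) (- d6) (d6\<^sup>2) (- cnj d6)) C6"
    by (rule X6_equivI[OF complex_hadamard_C6, of 1 5 3 6 4 2 2 6 4 5 3 1])
      (simp_all add: X6_C6_simps)
qed

lemmas X6_D6_simps = forall_6 X6_def vector_6 distinct_6 D6_def

text \<open>The first six cases pair all ordered choices from the roots 1, \<i>, -\<i> with the only
  cyclic order of 1, -1, -1. The last six pair the three choices from 1, -1, -1 with the two cyclic
  orders of 1, \<i>, -\<i>.\<close>

lemma X6_equiv_D6:
  "hadamard_equiv (X6 1 \<i> 1 (- 1)) D6"
  "hadamard_equiv (X6 1 (- \<i>) 1 (- 1)) D6"
  "hadamard_equiv (X6 \<i> 1 1 (- 1)) D6"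
  "hadamard_equiv (X6 \<i> (- \<i>) 1 (- 1)) D6"
  "hadamard_equiv (X6 (- \<i>) 1 1 (- 1)) D6"
  "hadamard_equiv (X6 (- \<i>) \<i> 1 (- 1)) D6"
  "hadamard_equiv (X6 1 (- 1) 1 \<i>) D6"
  "hadamard_equiv (X6 1 (- 1) 1 (- \<i>)) D6"
  "hadamard_equiv (X6 (- 1) 1 1 \<i>) D6"
  "hadamard_equiv (X6 (- 1) 1 1 (- \<i>)) D6"
  "hadamard_equiv (X6 (- 1) (- 1) 1 \<i>) D6"
  "hadamard_equiv (X6 (- 1) (- 1) 1 (- \<i>)) D6"
proof -
  show "hadamard_equiv (X6 1 \<i> 1 (- 1)) D6"
    by (rule X6_equivI[OF complex_hadamard_D6, of 1 2 3 5 6 4 2 3 1 4 5 6])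
      (simp_all add: X6_D6_simps)
  show "hadamard_equiv (X6 1 (- \<i>) 1 (- 1)) D6"
    by (rule X6_equivI[OF complex_hadamard_D6, of 1 2 4 6 3 5 2 4 1 5 6 3])
      (simp_all add: X6_D6_simps)
  show "hadamard_equiv (X6 \<i> 1 1 (- 1)) D6"
    by (rule X6_equivI[OF complex_hadamard_D6, of 1 2 4 5 6 3 1 2 4 5 6 3])
      (simp_all add: X6_D6_simps)
  show "hadamard_equiv (X6 \<i> (- \<i>) 1 (- 1)) D6"
    by (rule X6_equivI[OF complex_hadamard_D6, of 1 3 2 6 5 4 2 1 3 5 4 6])
      (simp_all add: X6_D6_simps)
  show "hadamard_equiv (X6 (- \<i>) 1 1 (- 1)) D6"
    by (rule X6_equivI[OF complex_hadamard_D6, of 1 2 3 4 5 6 1 2 3 4 5 6])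
      (simp_all add: X6_D6_simps)
  show "hadamard_equiv (X6 (- \<i>) \<i> 1 (- 1)) D6"
    by (rule X6_equivI[OF complex_hadamard_D6, of 1 4 2 3 6 5 2 1 4 6 5 3])
      (simp_all add: X6_D6_simps)
  show "hadamard_equiv (X6 1 (- 1) 1 \<i>) D6"
    by (rule X6_equivI[OF complex_hadamard_D6, of 1 4 3 6 5 2 2 6 5 4 3 1])
      (simp_all add: X6_D6_simps)
  show "hadamard_equiv (X6 1 (- 1) 1 (- \<i>)) D6"
    by (rule X6_equivI[OF complex_hadamard_D6, of 1 3 6 5 4 2 2 5 4 3 6 1])
      (simp_all add: X6_D6_simps)
  show "hadamard_equiv (X6 (- 1) 1 1 \<i>) D6"
    by (rule X6_equivI[OF complex_hadamard_D6, of 1 4 6 5 3 2 2 5 3 4 6 1])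
      (simp_all add: X6_D6_simps)
  show "hadamard_equiv (X6 (- 1) 1 1 (- \<i>)) D6"
    by (rule X6_equivI[OF complex_hadamard_D6, of 1 3 5 4 6 2 2 4 6 3 5 1])
      (simp_all add: X6_D6_simps)
  show "hadamard_equiv (X6 (- 1) (- 1) 1 \<i>) D6"
    by (rule X6_equivI[OF complex_hadamard_D6, of 1 3 4 5 6 2 2 5 6 3 4 1])
      (simp_all add: X6_D6_simps)
  show "hadamard_equiv (X6 (- 1) (- 1) 1 (- \<i>)) D6"
    by (rule X6_equivI[OF complex_hadamard_D6, of 1 4 5 6 3 2 2 6 3 4 5 1])
      (simp_all add: X6_D6_simps)
qed

section \<open>The region and its frontier\<close>

text \<open>The discriminant of \<open>f_poly \<alpha>\<close>.\<close>

definition disc :: "complex \<Rightarrow> real"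
  where "disc \<alpha> = cmod \<alpha> ^ 4 + 18 * cmod \<alpha> ^ 2 - 27 - 8 * Re (\<alpha> ^ 3)"

lemma disc_add_disc_uminus: "disc \<alpha> + disc (- \<alpha>) = 2 * (((cmod \<alpha>)\<^sup>2 + 9)\<^sup>2 - 108)"
  by (simp add: disc_def power2_eq_square power4_eq_xxxx algebra_simps)

text \<open>The bound is the extreme case \<open>Re (\<alpha> ^ 3) = - (cmod \<alpha> ^ 3)\<close>,
  in which the quartic in \<open>cmod \<alpha>\<close> factors.\<close>

lemma disc_le: "disc \<alpha> \<le> (cmod \<alpha> - 1) * (cmod \<alpha> + 3) ^ 3"
proof -
  have "- Re (\<alpha> ^ 3) \<le> cmod \<alpha> ^ 3"
    using abs_Re_le_cmod[of "\<alpha> ^ 3"] by (simp add: norm_power)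
  moreover have "(cmod \<alpha> - 1) * (cmod \<alpha> + 3) ^ 3
      = cmod \<alpha> ^ 4 + 18 * cmod \<alpha> ^ 2 - 27 + 8 * cmod \<alpha> ^ 3"
    by (simp add: power2_eq_square power3_eq_cube power4_eq_xxxx algebra_simps)
  ultimately show ?thesis
    by (simp add: disc_def)
qed

lemma continuous_on_disc: "continuous_on UNIV disc"
  unfolding disc_def by (intro continuous_intros)

section \<open>The range of \<open>phi\<close> as a deltoid\<close>

lemma deltoid_parametrization:
  obtains w m where "w \<in> \<T>" "\<alpha> = of_real m * w + (cnj w)\<^sup>2"
proof -
  \<comment> \<open>A zero \<open>t\<close> of \<open>g\<close> makes
    \<open>\<alpha> * cnj w - cnj w ^ 3\<close> real for \<open>w = cis t\<close>; this real number
    is \<open>m\<close>.\<close>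
  define g where "g t = Im (\<alpha> * cis (- t) - cis (- (3 * t)))" for t
  have cont: "continuous_on {0..pi} g"
    unfolding g_def by (intro continuous_intros)
  \<comment> \<open>\<open>g\<close> changes sign because \<open>g (t + pi) = - g t\<close>.\<close>
  have g_pi: "g pi = - g 0"
    by (simp add: g_def cis.ctr complex_eq_iff flip: cis_cnj)
  have "\<exists>t. g t = 0"
  proof (cases "g 0 \<le> 0")
    case True
    then show ?thesis
      using IVT'[of g 0 0 pi] cont g_pi by auto
  next
    case False
    then show ?thesis
      using IVT2'[of g pi 0 0] cont g_pi by auto
  qed
  then obtain t where "g t = 0" ..
  then obtain m where m: "\<alpha> * cis (- t) - cis (- (3 * t)) = of_real m"
    using complex_is_Real_iff Reals_cases unfolding g_def by metis
  have "\<alpha> = (\<alpha> * cis (- t)) * cis t"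
    by (simp add: mult.assoc cis_mult)
  also have "\<alpha> * cis (- t) = of_real m + cis (- (3 * t))"
    using m by (simp add: algebra_simps)
  also have "\<dots> * cis t = of_real m * cis t + (cnj (cis t))\<^sup>2"
    by (simp add: distrib_right cis_mult cis_cnj power2_eq_square)
  finally show ?thesis
    by (intro that[of "cis t" m]) simp_all
qed

text \<open>For \<bar>m\<bar> \<le> 2 the roots are \<open>p * w\<close>, \<open>cnj p * w\<close>
  and \<open>(cnj w)\<^sup>2\<close> with \<open>2 * Re p = m\<close> and \<open>p\<close> on the
  unit circle, and their differences produce the two factors. The computation covers every real
  \<open>m\<close> by writing the modulus and the real part of the cube as polynomials in
  \<open>m\<close> and \<open>t\<close>.\<close>

lemma disc_deltoid:
  assumes "w \<in> \<T>"
  shows "disc (of_real m * w + (cnj w)\<^sup>2) = (m\<^sup>2 - 4) * (m - 2 * Re (w ^ 3))\<^sup>2"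
proof -
  define t where "t = Re (w ^ 3)"
  let ?\<alpha> = "of_real m * w + (cnj w)\<^sup>2"
  have w: "w * cnj w = 1" "w * (cnj w * z) = z" for z
    using unit_circle_mult_cnj[OF assms] by (simp_all flip: mult.assoc)
  have sum3: "w ^ 3 + cnj w ^ 3 = of_real (2 * t)"
    by (simp add: t_def complex_add_cnj flip: complex_cnj_power)
  have sum6: "w ^ 6 + cnj w ^ 6 = of_real (4 * t\<^sup>2 - 2)"
  proof -
    have "w ^ 6 + cnj w ^ 6 = (w ^ 3 + cnj w ^ 3)\<^sup>2 - 2 * (w * cnj w) ^ 3"
      by (simp add: algebra_simps power2_eq_square eval_nat_numeral)
    then show ?thesis
      by (simp add: sum3 w power2_eq_square)
  qed
  have norm: "(cmod ?\<alpha>)\<^sup>2 = m\<^sup>2 + 1 + 2 * m * t"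
  proof -
    have "complex_of_real ((cmod ?\<alpha>)\<^sup>2) = ?\<alpha> * cnj ?\<alpha>"
      by (rule complex_norm_square)
    also have "\<dots> = of_real m ^ 2 * (w * cnj w) + of_real m * (w ^ 3 + cnj w ^ 3) + (w * cnj w)\<^sup>2"
      by (simp add: algebra_simps power2_eq_square power3_eq_cube)
    also have "\<dots> = of_real (m\<^sup>2 + 1 + 2 * m * t)"
      by (simp add: sum3 w)
    finally show ?thesis
      using of_real_eq_iff by blast
  qed
  have cube: "2 * Re (?\<alpha> ^ 3) = 2 * m ^ 3 * t + 6 * m\<^sup>2 + 6 * m * t + 4 * t\<^sup>2 - 2"
  proof -
    have "complex_of_real (2 * Re (?\<alpha> ^ 3)) = ?\<alpha> ^ 3 + cnj (?\<alpha> ^ 3)"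
      by (rule complex_add_cnj[symmetric])
    also have "\<dots> = of_real m ^ 3 * (w ^ 3 + cnj w ^ 3) + 6 * of_real m ^ 2 * (w * cnj w)\<^sup>2
        + 3 * of_real m * (w * cnj w) * (w ^ 3 + cnj w ^ 3) + (w ^ 6 + cnj w ^ 6)"
      by (simp add: algebra_simps eval_nat_numeral)
    also have "\<dots> = of_real (2 * m ^ 3 * t + 6 * m\<^sup>2 + 6 * m * t + 4 * t\<^sup>2 - 2)"
      by (simp add: sum3 sum6 w)
    finally show ?thesis
      using of_real_eq_iff by blast
  qed
  have "disc ?\<alpha> = ((cmod ?\<alpha>)\<^sup>2)\<^sup>2 + 18 * (cmod ?\<alpha>)\<^sup>2 - 27 - 4 * (2 * Re (?\<alpha> ^ 3))"
    by (simp add: disc_def)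
  also have "\<dots> = (m\<^sup>2 - 4) * (m - 2 * t)\<^sup>2"
    unfolding norm cube by (simp add: algebra_simps eval_nat_numeral)
  finally show ?thesis
    by (simp add: t_def)
qed

lemma range_phi: "{phi x y |x y. x \<in> \<T> \<and> y \<in> \<T>} = {\<alpha>. disc \<alpha> \<le> 0}"
proof (intro equalityI subsetI)
  fix \<alpha>
  assume "\<alpha> \<in> {phi x y |x y. x \<in> \<T> \<and> y \<in> \<T>}"
  then obtain x y where x: "x \<in> \<T>" and y: "y \<in> \<T>" and \<alpha>: "\<alpha> = phi x y"
    by auto
  \<comment> \<open>A square root of the product makes the pair symmetric about it:
    \<open>x = p * w\<close> and \<open>y = cnj p * w\<close>, so \<open>x + y\<close> is a real
    multiple of \<open>w\<close>.\<close>
  define w where "w = csqrt (x * y)"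
  have w2: "w\<^sup>2 = x * y"
    by (simp add: w_def)
  have "cmod w = 1"
    using x y by (simp add: w_def norm_mult)
  then have w: "w \<in> \<T>" "w * cnj w = 1"
    using unit_circle_mult_cnj[of w] by simp_all
  have nz: "x \<noteq> 0" "w \<noteq> 0"
    using x \<open>cmod w = 1\<close> by auto
  define p where "p = x * cnj w"
  have cnj_x: "cnj x = inverse x" and cnj_w: "cnj w = inverse w"
    using unit_circle_mult_cnj[OF x] w(2) by (simp_all add: inverse_unique)
  have "x = p * w" "y = cnj p * w"
    using w2 nz by (simp_all add: p_def cnj_x cnj_w field_simps power2_eq_square)
  then have "x + y = of_real (2 * Re p) * w"
    by (simp add: complex_add_cnj flip: distrib_right)
  moreover have "1 / (x * y) = (cnj w)\<^sup>2"
    using w2 by (simp add: cnj_w power_inverse divide_inverse flip: w2)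
  ultimately have "disc \<alpha> = ((2 * Re p)\<^sup>2 - 4) * (2 * Re p - 2 * Re (w ^ 3))\<^sup>2"
    using disc_deltoid[OF w(1), of "2 * Re p"] by (simp add: \<alpha> phi_def)
  moreover have "(2 * Re p)\<^sup>2 \<le> 4"
  proof -
    have "\<bar>Re p\<bar> \<le> 1"
      using abs_Re_le_cmod[of p] x w(1) by (simp add: p_def norm_mult)
    then show ?thesis
      by (simp add: power_mult_distrib abs_square_le_1)
  qed
  ultimately show "\<alpha> \<in> {\<alpha>. disc \<alpha> \<le> 0}"
    by (simp add: mult_nonpos_nonneg)
next
  fix \<alpha>
  assume "\<alpha> \<in> {\<alpha>. disc \<alpha> \<le> 0}"
  then have disc: "disc \<alpha> \<le> 0"
    by simp
  obtain w m where w: "w \<in> \<T>" and \<alpha>: "\<alpha> = of_real m * w + (cnj w)\<^sup>2"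
    by (rule deltoid_parametrization)
  \<comment> \<open>For \<bar>m\<bar> > 2 the first factor of the discriminant is positive, so the
    squared factor must vanish; but then \<open>m = 2 * Re (w ^ 3)\<close> lies between -2 and
    2.\<close>
  have m: "m\<^sup>2 \<le> 4"
  proof (rule ccontr)
    assume "\<not> m\<^sup>2 \<le> 4"
    then have m4: "m\<^sup>2 - 4 > 0"
      by simp
    then have "(m - 2 * Re (w ^ 3))\<^sup>2 = 0"
      using disc unfolding \<alpha> disc_deltoid[OF w] by (simp add: mult_le_0_iff)
    then have "m = 2 * Re (w ^ 3)"
      by simp
    moreover have "\<bar>Re (w ^ 3)\<bar> \<le> 1"
      using abs_Re_le_cmod[of "w ^ 3"] w by (simp add: norm_power)
    ultimately have "m\<^sup>2 \<le> 4"
      by (simp add: power_mult_distrib abs_square_le_1)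
    with m4 show False by simp
  qed
  \<comment> \<open>The point of the unit circle with real part \<open>m / 2\<close>: then
    \<open>p * w\<close> and \<open>cnj p * w\<close> have sum \<open>m * w\<close> and product
    \<open>w\<^sup>2\<close>.\<close>
  define p where "p = Complex (m / 2) (sqrt (1 - m\<^sup>2 / 4))"
  have "(cmod p)\<^sup>2 = 1"
    using m by (simp add: p_def cmod_power2 power_divide)
  then have p: "p \<in> \<T>"
    using norm_ge_zero[of p] by (auto simp: power2_eq_1_iff simp del: norm_ge_zero)
  have "(p * w) * (cnj p * w) = w\<^sup>2"
    using unit_circle_mult_cnj[OF p] by (simp add: power2_eq_square mult_ac)
  moreover have "1 / w\<^sup>2 = (cnj w)\<^sup>2"
    using inverse_unique[OF unit_circle_mult_cnj[OF w]] by (simp add: divide_inverse flip: power_inverse)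
  moreover have "p * w + cnj p * w = of_real m * w"
    by (simp add: p_def complex_add_cnj flip: distrib_right)
  ultimately have "\<alpha> = phi (p * w) (cnj p * w)"
    by (simp add: phi_def \<alpha>)
  moreover have "p * w \<in> \<T>" "cnj p * w \<in> \<T>"
    using p w by (simp_all add: norm_mult)
  ultimately show "\<alpha> \<in> {phi x y |x y. x \<in> \<T> \<and> y \<in> \<T>}"
    by blast
qed

lemma region_D_iff: "\<alpha> \<in> \<D> \<longleftrightarrow> disc \<alpha> \<le> 0 \<and> disc (- \<alpha>) \<le> 0"
proof -
  have "\<alpha> \<in> {- phi x y |x y. x \<in> \<T> \<and> y \<in> \<T>} \<longleftrightarrow> - \<alpha> \<in> {phi x y |x y. x \<in> \<T> \<and> y \<in> \<T>}"
    by (auto simp: eq_commute[of "- \<alpha>"] minus_equation_iff[of \<alpha>] equation_minus_iff[of \<alpha>])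
  then show ?thesis
    unfolding region_D_def Int_iff range_phi by auto
qed

section \<open>Bounds for the modulus on the region and on its frontier\<close>

lemma region_D_cmod_le:
  assumes "\<alpha> \<in> \<D>"
  shows "cmod \<alpha> \<le> sqrt (- 9 + 6 * sqrt 3)"
proof -
  have "((cmod \<alpha>)\<^sup>2 + 9)\<^sup>2 \<le> 108"
    using assms disc_add_disc_uminus[of \<alpha>] by (simp add: region_D_iff)
  also have "108 = (6 * sqrt 3)\<^sup>2"
    by (simp add: power_mult_distrib)
  finally have "(cmod \<alpha>)\<^sup>2 + 9 \<le> 6 * sqrt 3"
    by (rule power2_le_imp_le) simp
  then show ?thesis
    by (intro real_le_rsqrt) simp
qed

lemma sqrt3_ge: "9 < 6 * sqrt (3::real)"
  by (rule power2_less_imp_less) (simp_all add: power_mult_distrib)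

text \<open>On this circle the two discriminants sum to 0, so both are nonpositive only if both
  vanish, which happens exactly when their difference \<open>16 * Re (\<alpha> ^ 3)\<close>
  does.\<close>

lemma region_D_cmod_eq:
  assumes "cmod \<alpha> = sqrt (- 9 + 6 * sqrt 3)"
  shows "\<alpha> \<in> \<D> \<longleftrightarrow> Re (\<alpha> ^ 3) = 0"
proof -
  have "(cmod \<alpha>)\<^sup>2 + 9 = 6 * sqrt 3"
    using sqrt3_ge by (simp add: assms)
  then have "disc \<alpha> + disc (- \<alpha>) = 0"
    by (simp add: disc_add_disc_uminus power_mult_distrib)
  moreover have "disc (- \<alpha>) = disc \<alpha> + 16 * Re (\<alpha> ^ 3)"
    by (simp add: disc_def)
  ultimately show ?thesis
    unfolding region_D_iff by linarith
qed

lemma continuous_on_disc_uminus: "continuous_on UNIV (\<lambda>\<alpha>. disc (- \<alpha>))"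
  unfolding disc_def by (intro continuous_intros)

lemma closed_region_D: "closed \<D>"
proof -
  have D: "\<D> = {\<alpha>. disc \<alpha> \<le> 0} \<inter> {\<alpha>. disc (- \<alpha>) \<le> 0}"
    by (auto simp: region_D_iff)
  show ?thesis
    unfolding D by (intro closed_Int closed_Collect_le continuous_on_disc continuous_on_disc_uminus
        continuous_on_const)
qed

lemma interior_region_D:
  assumes "disc \<alpha> < 0" "disc (- \<alpha>) < 0"
  shows "\<alpha> \<in> interior \<D>"
proof (rule interiorI)
  show "open ({\<alpha>. disc \<alpha> < 0} \<inter> {\<alpha>. disc (- \<alpha>) < 0})"
    by (intro open_Int open_Collect_less continuous_on_disc continuous_on_disc_uminus
        continuous_on_const)
qed (use assms in \<open>auto simp: region_D_iff\<close>)

lemma frontier_region_D_cmod: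
  assumes "\<alpha> \<in> frontier \<D>"
  shows "1 \<le> cmod \<alpha>" and "cmod \<alpha> = 1 \<Longrightarrow> \<alpha> ^ 6 = 1"
proof -
  have "\<alpha> \<notin> interior \<D>"
    using assms by (simp add: frontier_def)
  then have disc: "disc \<alpha> \<ge> 0 \<or> disc (- \<alpha>) \<ge> 0"
    using interior_region_D[of \<alpha>] by linarith
  then have "(cmod \<alpha> - 1) * (cmod \<alpha> + 3) ^ 3 \<ge> 0"
    using disc_le[of \<alpha>] disc_le[of "- \<alpha>"] by auto
  moreover have "(cmod \<alpha> + 3) ^ 3 > 0"
    using norm_ge_zero[of \<alpha>] by (intro zero_less_power) linarith
  ultimately show "1 \<le> cmod \<alpha>"
    by (simp add: zero_le_mult_iff)
  assume 1: "cmod \<alpha> = 1"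
  have "cmod (\<alpha> ^ 3) = 1"
    by (simp add: 1 norm_power)
  then have norm3: "(Re (\<alpha> ^ 3))\<^sup>2 + (Im (\<alpha> ^ 3))\<^sup>2 = 1"
    by (simp flip: cmod_power2)
  \<comment> \<open>At modulus 1 the two discriminants are
    \<open>- 8 - 8 * Re (\<alpha> ^ 3)\<close> and
    \<open>- 8 + 8 * Re (\<alpha> ^ 3)\<close>.\<close>
  have "1 \<le> \<bar>Re (\<alpha> ^ 3)\<bar>"
    using disc by (auto simp: disc_def 1)
  then have "1 \<le> (Re (\<alpha> ^ 3))\<^sup>2"
    using power_mono[of 1 "\<bar>Re (\<alpha> ^ 3)\<bar>" 2] by simp
  then have "(Im (\<alpha> ^ 3))\<^sup>2 = 0" and Re: "(Re (\<alpha> ^ 3))\<^sup>2 = 1"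
    using norm3 zero_le_power2[of "Im (\<alpha> ^ 3)"] by linarith+
  then have "\<alpha> ^ 3 = of_real (Re (\<alpha> ^ 3))"
    by (simp add: complex_eq_iff)
  then have "(\<alpha> ^ 3)\<^sup>2 = of_real ((Re (\<alpha> ^ 3))\<^sup>2)"
    by (metis of_real_power)
  then show "\<alpha> ^ 6 = 1"
    unfolding Re by (simp flip: power_mult)
qed

lemma frontier_region_D_root_of_unity:
  assumes "\<alpha> ^ 6 = 1"
  shows "\<alpha> \<in> frontier \<D>" and "cmod \<alpha> = 1"
proof -
  show norm: "cmod \<alpha> = 1"
    using assms by (metis power_eq_1_iff zero_neq_numeral)
  have "(\<alpha> ^ 3)\<^sup>2 = 1"
    using assms by (simp flip: power_mult)
  then have cube: "\<alpha> ^ 3 = 1 \<or> \<alpha> ^ 3 = - 1"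
    by (rule power2_eq_1_iff[THEN iffD1])
  then have "\<alpha> \<in> \<D>"
    by (auto simp: region_D_iff disc_def norm)
  moreover have "\<alpha> \<notin> interior \<D>"
  proof
    assume "\<alpha> \<in> interior \<D>"
    then obtain e where e: "e > 0" "cball \<alpha> e \<subseteq> \<D>"
      by (auto simp: mem_interior_cball)
    \<comment> \<open>Move radially outward by \<open>e\<close>. The cube stays real on this ray, so
      one of the two discriminants attains the bound of \<open>disc_le\<close>, here
      \<open>e * (e + 4) ^ 3 > 0\<close>.\<close>
    define \<beta> where "\<beta> = of_real (1 + e) * \<alpha>"
    have "dist \<alpha> \<beta> = e"
      using e(1) by (simp add: \<beta>_def dist_norm algebra_simps norm_mult norm)
    then have "\<beta> \<in> \<D>"
      using e(2) by (auto simp: subset_iff)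
    have s: "cmod \<beta> = 1 + e"
      using e(1) by (simp add: \<beta>_def norm_mult norm del: of_real_add)
    have "\<beta> ^ 3 = of_real ((1 + e) ^ 3) * \<alpha> ^ 3"
      by (simp add: \<beta>_def power_mult_distrib)
    then have "\<bar>Re (\<beta> ^ 3)\<bar> = (1 + e) ^ 3"
      using cube e(1) by (auto simp del: of_real_power of_real_add)
    moreover have "disc \<beta> \<le> 0" "disc (- \<beta>) \<le> 0"
      using \<open>\<beta> \<in> \<D>\<close> by (simp_all add: region_D_iff)
    ultimately have "(1 + e) ^ 4 + 18 * (1 + e) ^ 2 - 27 + 8 * (1 + e) ^ 3 \<le> 0"
      by (simp add: disc_def s abs_if split: if_splits)
    moreover have "(1 + e) ^ 4 + 18 * (1 + e) ^ 2 - 27 + 8 * (1 + e) ^ 3 = e * (e + 4) ^ 3"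
      by (simp add: eval_nat_numeral algebra_simps)
    ultimately show False
      using e(1) by (simp add: mult_le_0_iff)
  qed
  ultimately show "\<alpha> \<in> frontier \<D>"
    using closed_region_D by (simp add: frontier_def)
qed

section \<open>The extremal points as sixth roots\<close>

lemma alpha_min_eq: "alpha_min k = cis (2 * pi * real k / real 6)"
  by (simp add: alpha_min_def cis_conv_exp mult_ac)

lemma alpha_min_image: "alpha_min ` {1..6} = {z. z ^ 6 = 1}"
proof (intro equalityI subsetI)
  fix z
  assume "z \<in> alpha_min ` {1..6}"
  then obtain k where z: "z = cis (2 * pi * real k / real 6)"
    unfolding alpha_min_eq by blast
  have "z ^ 6 = cis (real 6 * (2 * pi * real k / real 6))"
    unfolding z by (rule Complex.DeMoivre)
  also have "real 6 * (2 * pi * real k / real 6) = 2 * pi * real k"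
    by simp
  also have "cis (2 * pi * real k) = 1"
    by (rule cis_multiple_2pi) simp
  finally show "z \<in> {z. z ^ 6 = 1}" ..
next
  fix z :: complex
  assume "z \<in> {z. z ^ 6 = 1}"
  moreover have "bij_betw (\<lambda>k. cis (2 * pi * real k / real 6)) {..<6} {z. z ^ 6 = 1}"
    by (rule Complex.bij_betw_roots_unity) simp
  then have "{z. z ^ 6 = 1} = alpha_min ` {..<6}"
    unfolding alpha_min_eq by (metis bij_betw_imp_surj_on)
  ultimately obtain k where k: "k < 6" and z: "z = alpha_min k"
    by (metis imageE lessThan_iff)
  show "z \<in> alpha_min ` {1..6}"
  \<comment> \<open>The roots of unity are enumerated from 0 to 5, the extremal points from 1 to 6;
    index 0 becomes 6.\<close>
  proof (cases "k = 0")
    case True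
    then have "z = alpha_min 6"
      unfolding z alpha_min_eq by simp
    then show ?thesis by simp
  next
    case False
    then show ?thesis
      unfolding z using k by (intro imageI) simp
  qed
qed

lemma alpha_max_eq: "alpha_max k = of_real (sqrt (- 9 + 6 * sqrt 3)) * cis (pi / 6) * alpha_min k"
  by (simp add: alpha_max_def alpha_min_def cis_conv_exp mult.assoc distrib_left flip: exp_add)

text \<open>Both \<open>cis (pi / 6)\<close> and \<i> have sixth power -1. The right-hand side uses
  \<i> because the roots at that point of the orbit are expressed through \<open>d6\<close>.\<close>

lemma alpha_max_image: "alpha_max ` {1..6} = {z. z ^ 6 = (\<i> * of_real (sqrt (- 9 + 6 * sqrt 3))) ^ 6}"
proof -
  define c where "c = of_real (sqrt (- 9 + 6 * sqrt 3)) * cis (pi / 6)"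
  have "c \<noteq> 0"
    using sqrt3_ge by (simp add: c_def)
  have c6: "c ^ 6 = (\<i> * of_real (sqrt (- 9 + 6 * sqrt 3))) ^ 6"
    by (simp add: c_def power_mult_distrib Complex.DeMoivre)
  have "alpha_max ` {1..6} = (*) c ` {z. z ^ 6 = 1}"
    unfolding alpha_max_eq c_def alpha_min_image[symmetric] image_image ..
  also have "\<dots> = {z. z ^ 6 = c ^ 6}"
  proof (intro equalityI subsetI)
    fix z
    assume "z \<in> {z. z ^ 6 = c ^ 6}"
    then have "z = c * (z / c)" "(z / c) ^ 6 = 1"
      using \<open>c \<noteq> 0\<close> by (simp_all add: power_divide)
    then show "z \<in> (*) c ` {z. z ^ 6 = 1}"
      by blast
  qed (auto simp: power_mult_distrib)
  finally show ?thesis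
    by (simp add: c6)
qed

text \<open>The square of \<open>\<alpha> ^ 3\<close> is a negative real exactly when
  \<open>\<alpha> ^ 3\<close> is nonzero and purely imaginary; its size fixes the modulus.\<close>

lemma alpha_max_iff:
  "\<alpha> \<in> alpha_max ` {1..6} \<longleftrightarrow> cmod \<alpha> = sqrt (- 9 + 6 * sqrt 3) \<and> Re (\<alpha> ^ 3) = 0"
proof -
  define S where "S = sqrt (- 9 + 6 * sqrt 3)"
  have S: "S > 0"
    using sqrt3_ge by (simp add: S_def)
  have iS: "(\<i> * of_real S) ^ 6 = - of_real (S ^ 6)"
    by (simp add: power_mult_distrib)
  have "\<alpha> ^ 6 = - of_real (S ^ 6) \<longleftrightarrow> cmod \<alpha> = S \<and> Re (\<alpha> ^ 3) = 0"
  proof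
    assume eq: "\<alpha> ^ 6 = - of_real (S ^ 6)"
    have "cmod \<alpha> ^ 6 = cmod (- of_real (S ^ 6))"
      by (simp only: eq flip: norm_power)
    then have "cmod \<alpha> ^ 6 = S ^ 6"
      using S by (simp add: norm_power)
    then have "cmod \<alpha> = S"
      using S by (simp add: power_eq_iff_eq_base)
    moreover define z where "z = \<alpha> ^ 3"
    have "z * z = of_real (- (S ^ 6))"
      using eq by (simp add: z_def flip: power_add)
    from arg_cong[OF this, of Re] arg_cong[OF this, of Im]
    have "Re z * Re z - Im z * Im z = - (S ^ 6)" and "Re z * Im z = 0"
      by (simp_all only: times_complex.sel Re_complex_of_real Im_complex_of_real) auto
    then have "Re z = 0"
      using S by (smt (verit) mult_eq_0_iff zero_le_square zero_less_power)
    then have "Re (\<alpha> ^ 3) = 0"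
      by (simp add: z_def)
    ultimately show "cmod \<alpha> = S \<and> Re (\<alpha> ^ 3) = 0" ..
  next
    assume "cmod \<alpha> = S \<and> Re (\<alpha> ^ 3) = 0"
    then have S_eq: "cmod \<alpha> = S" and "Re (\<alpha> ^ 3) = 0"
      by auto
    then have "\<alpha> ^ 3 + cnj (\<alpha> ^ 3) = 0"
      by (subst complex_add_cnj) simp
    then have "cnj (\<alpha> ^ 3) = - (\<alpha> ^ 3)"
      by (simp add: eq_neg_iff_add_eq_0 add.commute)
    then have "\<alpha> ^ 6 = - (\<alpha> ^ 3 * cnj (\<alpha> ^ 3))"
      by (simp flip: power_add)
    also have "\<alpha> ^ 3 * cnj (\<alpha> ^ 3) = of_real ((cmod (\<alpha> ^ 3))\<^sup>2)"
      by (rule complex_norm_square[symmetric])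
    also have "\<dots> = of_real (S ^ 6)"
      by (simp add: norm_power S_eq flip: power_mult)
    finally show "\<alpha> ^ 6 = - of_real (S ^ 6)" .
  qed
  then show ?thesis
    unfolding alpha_max_image S_def[symmetric] mem_Collect_eq iS .
qed

section \<open>Admissible quadruples\<close>

lemma ex_third_nth:
  assumes "length r = 3" "i < 3" "j < 3" "i \<noteq> j"
  shows "\<exists>z. mset r = {#r ! i, r ! j, z#}"
proof -
  obtain a b c where r: "r = [a, b, c]"
    using assms(1) by (auto simp: numeral_3_eq_3 length_Suc_conv)
  have "i \<in> {0, 1, 2}" "j \<in> {0, 1, 2}"
    using assms by auto
  with assms(4) show ?thesis
    by (auto simp: r add_mset_commute)
qed

text \<open>Vieta's formulas: a monic complex cubic is the product of the linear factors given by
  its root multiset.\<close>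

lemma proots_f_poly_iff:
  "proots (f_poly \<alpha>) = {#x, y, z#} \<longleftrightarrow>
    x + y + z = \<alpha> \<and> x * y + y * z + z * x = cnj \<alpha> \<and> x * y * z = 1"
proof -
  have "proots (f_poly \<alpha>) = {#x, y, z#} \<longleftrightarrow> f_poly \<alpha> = [:- x, 1:] * [:- y, 1:] * [:- z, 1:]"
  proof
    assume p: "proots (f_poly \<alpha>) = {#x, y, z#}"
    have "lead_coeff (f_poly \<alpha>) = 1"
      by (simp add: f_poly_def)
    then show "f_poly \<alpha> = [:- x, 1:] * [:- y, 1:] * [:- z, 1:]"
      using complex_poly_decompose_multiset[of "f_poly \<alpha>"]
      by (simp add: p mult_ac del: mult_pCons_left mult_pCons_right)
  next
    assume "f_poly \<alpha> = [:- x, 1:] * [:- y, 1:] * [:- z, 1:]"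
    then show "proots (f_poly \<alpha>) = {#x, y, z#}"
      by (simp add: proots_mult add_mset_commute del: mult_pCons_left mult_pCons_right)
  qed
  also have "\<dots> \<longleftrightarrow> x + y + z = \<alpha> \<and> x * y + y * z + z * x = cnj \<alpha> \<and> x * y * z = 1"
    by (auto simp: f_poly_def algebra_simps)
  finally show ?thesis .
qed

text \<open>Restores the third root of each cubic, which the cyclic symmetry and Vieta's formulas
  require.\<close>

lemma admissibleE:
  assumes "admissible \<alpha> x y u v"
  obtains z w where "proots (f_poly \<alpha>) = {#x, y, z#}" "proots (f_poly (- \<alpha>)) = {#u, v, w#}"
proof -
  obtain r q i j k l where rq: "mset r = proots (f_poly \<alpha>)" "mset q = proots (f_poly (- \<alpha>))"
    and ij: "i < 3" "j < 3" "i \<noteq> j" "x = r ! i" "y = r ! j"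
    and kl: "k < 3" "l < 3" "k \<noteq> l" "u = q ! k" "v = q ! l"
    using assms unfolding admissible_def by blast
  have "size (proots (f_poly \<beta>)) = 3" for \<beta>
    by (simp add: size_proots_complex f_poly_def)
  then have "length r = 3" "length q = 3"
    using rq by (metis size_mset)+
  then show ?thesis
    using ex_third_nth[of r i j] ex_third_nth[of q k l] rq ij kl that by auto
qed

text \<open>Since \<open>cnj \<omega> = \<omega> * \<omega>\<close>, the coefficient
  \<open>cnj \<alpha>\<close> scales exactly as the second elementary symmetric function of the
  roots.\<close>

lemma proots_f_poly_rotate:
  assumes "\<omega> ^ 3 = 1" "proots (f_poly (\<omega> * \<alpha>)) = {#x, y, z#}"
  shows "proots (f_poly \<alpha>) = {#x / \<omega>, y / \<omega>, z / \<omega>#}"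
proof -
  have \<omega>: "\<omega> \<noteq> 0" "\<omega> * \<omega> * \<omega> = 1"
    using assms(1) by (auto simp: power3_eq_cube)
  have "cmod \<omega> = 1"
    using assms(1) by (metis power_eq_1_iff zero_neq_numeral)
  then have "\<omega> * cnj \<omega> = 1"
    using unit_circle_mult_cnj[of \<omega>] by simp
  then have "cnj \<omega> = \<omega> * \<omega>"
    using \<omega> by (metis mult.assoc mult_cancel_left)
  then have "x + y + z = \<omega> * \<alpha>" "x * y + y * z + z * x = \<omega> * \<omega> * cnj \<alpha>" "x * y * z = 1"
    using assms(2) by (simp_all add: proots_f_poly_iff)
  then show ?thesis
    using \<omega> by (simp add: proots_f_poly_iff flip: add_divide_distrib)
qed

text \<open>Equal sixth powers mean equal cubes up to sign, so \<alpha> is a cube root of unity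
  times \<open>\<alpha>0\<close> or \<open>- \<alpha>0\<close>; dividing the roots by that unit
  leaves \<open>X6\<close> fixed.\<close>

lemma admissible_reduce:
  assumes "admissible \<alpha> x y u v" "\<alpha> ^ 6 = \<alpha>0 ^ 6" "\<alpha>0 \<noteq> 0"
  obtains \<beta> x' y' z' u' v' w' where "\<beta> \<in> {\<alpha>0, - \<alpha>0}" "X6 x y u v = X6 x' y' u' v'"
    "proots (f_poly \<beta>) = {#x', y', z'#}" "proots (f_poly (- \<beta>)) = {#u', v', w'#}"
proof -
  have "(\<alpha> ^ 3)\<^sup>2 = (\<alpha>0 ^ 3)\<^sup>2"
    using assms(2) by (simp flip: power_mult)
  then have "\<alpha> ^ 3 = \<alpha>0 ^ 3 \<or> \<alpha> ^ 3 = - (\<alpha>0 ^ 3)"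
    by (rule power2_eq_iff[THEN iffD1])
  then have "\<alpha> ^ 3 = \<alpha>0 ^ 3 \<or> \<alpha> ^ 3 = (- \<alpha>0) ^ 3"
    by simp
  then obtain \<beta> where \<beta>: "\<beta> \<in> {\<alpha>0, - \<alpha>0}" "\<alpha> ^ 3 = \<beta> ^ 3"
    by blast
  define \<omega> where "\<omega> = \<alpha> / \<beta>"
  have "\<beta> \<noteq> 0"
    using \<beta>(1) assms(3) by auto
  then have \<omega>: "\<omega> ^ 3 = 1" "\<alpha> = \<omega> * \<beta>"
    using \<beta>(2) by (simp_all add: \<omega>_def power_divide)
  obtain z w where "proots (f_poly \<alpha>) = {#x, y, z#}" "proots (f_poly (- \<alpha>)) = {#u, v, w#}"
    using assms(1) by (rule admissibleE)
  then have "proots (f_poly \<beta>) = {#x / \<omega>, y / \<omega>, z / \<omega>#}"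
    "proots (f_poly (- \<beta>)) = {#u / \<omega>, v / \<omega>, w / \<omega>#}"
    using \<omega> by (auto intro!: proots_f_poly_rotate)
  moreover have "X6 x y u v = X6 (x / \<omega>) (y / \<omega>) (u / \<omega>) (v / \<omega>)"
    using X6_scale[OF \<omega>(1), of "x / \<omega>" "y / \<omega>" "u / \<omega>" "v / \<omega>"] \<omega>(1) by (cases "\<omega> = 0") auto
  ultimately show ?thesis
    using that \<beta>(1) by blast
qed

lemma add_mset_triple_cases:
  assumes "{#x, y, z#} = {#a, b, c#}"
  shows "(x, y, z) \<in> {(a, b, c), (a, c, b), (b, a, c), (b, c, a), (c, a, b), (c, b, a)}"
  using assms by (auto simp: add_eq_conv_ex)

text \<open>The six orders of \<open>a\<close>, \<open>b\<close>, \<open>c\<close> form two cyclic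
  classes, represented by the pairs \<open>a, b\<close> and \<open>a, c\<close>.\<close>

lemma X6_permute:
  assumes "{#u, v, w#} = {#a, b, c#}" "a * b * c = 1"
    "hadamard_equiv (X6 x y a b) K" "hadamard_equiv (X6 x y a c) K"
  shows "hadamard_equiv (X6 x y u v) K"
proof -
  have rotate: "hadamard_equiv (X6 x y c a) K" "hadamard_equiv (X6 x y b c) K"
    if "a * b * c = 1" "hadamard_equiv (X6 x y a b) K" for a b c
  proof -
    show ca: "hadamard_equiv (X6 x y c a) K"
      using that by (intro X6_rotate[of c a b]) (simp_all add: mult_ac)
    show "hadamard_equiv (X6 x y b c) K"
      using that(1) by (intro X6_rotate[OF _ ca]) (simp add: mult_ac)
  qed
  have "a * c * b = 1"
    using assms(2) by (simp add: mult_ac)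
  then show ?thesis
    using add_mset_triple_cases[OF assms(1)] assms(3,4) rotate[OF assms(2,3)] rotate[OF _ assms(4)]
    by auto
qed

text \<open>The right-hand side is the sum of \<open>d6\<^sup>2\<close>, \<open>- cnj d6\<close> and
  \<open>- cnj d6\<close>, three unit numbers with product 1 that turn out to be the roots at this
  point.\<close>

lemma imag_sqrt_d6: "\<i> * of_real (sqrt (- 9 + 6 * sqrt 3)) = d6\<^sup>2 - 2 * cnj d6"
proof -
  define h where "h = sqrt (sqrt 3 / 2)"
  have h2: "h * h = sqrt 3 / 2"
    by (simp add: h_def)
  have "sqrt 3 \<le> sqrt 9"
    by (intro real_sqrt_le_mono) simp
  then have "0 \<le> h * (3 - sqrt 3)"
    by (simp add: h_def)
  moreover have "(h * (3 - sqrt 3))\<^sup>2 = - 9 + 6 * sqrt 3"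
    unfolding power_mult_distrib power2_eq_square[of h] h2 by (simp add: power2_eq_square algebra_simps)
  ultimately have "sqrt (- 9 + 6 * sqrt 3) = h * (3 - sqrt 3)"
    by (metis real_sqrt_unique)
  then show ?thesis
    unfolding d6_def h_def[symmetric]
    by (simp add: complex_eq_iff power2_eq_square h2 field_simps)
qed

section \<open>Extremal points and the equivalence classes at them\<close>

lemma card_sixth_roots: "c \<noteq> 0 \<Longrightarrow> card {z::complex. z ^ 6 = c} = 6"
  by (rule Complex.card_nth_roots) simp_all

lemma maximal_points: "{\<alpha> \<in> \<D>. \<forall>\<beta> \<in> \<D>. cmod \<beta> \<le> cmod \<alpha>} = alpha_max ` {1..6}"
proof -
  have D: "\<alpha> \<in> \<D>" if "\<alpha> \<in> alpha_max ` {1..6}" for \<alpha>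
    using that region_D_cmod_eq[of \<alpha>] unfolding alpha_max_iff by blast
  \<comment> \<open>One point attaining the modulus bound forces every maximizer onto that
    circle.\<close>
  have "alpha_max 1 \<in> alpha_max ` {1..6}"
    by (intro imageI) simp
  then have 1: "alpha_max 1 \<in> \<D>" "cmod (alpha_max 1) = sqrt (- 9 + 6 * sqrt 3)"
    using D unfolding alpha_max_iff by blast+
  show ?thesis
  proof (intro equalityI subsetI)
    fix \<alpha>
    assume "\<alpha> \<in> {\<alpha> \<in> \<D>. \<forall>\<beta> \<in> \<D>. cmod \<beta> \<le> cmod \<alpha>}"
    then have \<alpha>: "\<alpha> \<in> \<D>" "cmod (alpha_max 1) \<le> cmod \<alpha>"
      using 1(1) by blast+
    then have "cmod \<alpha> = sqrt (- 9 + 6 * sqrt 3)"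
      using region_D_cmod_le[of \<alpha>] 1(2) by linarith
    then show "\<alpha> \<in> alpha_max ` {1..6}"
      using \<alpha>(1) region_D_cmod_eq unfolding alpha_max_iff by blast
  next
    fix \<alpha>
    assume \<alpha>: "\<alpha> \<in> alpha_max ` {1..6}"
    then have "cmod \<alpha> = sqrt (- 9 + 6 * sqrt 3)"
      unfolding alpha_max_iff by blast
    then show "\<alpha> \<in> {\<alpha> \<in> \<D>. \<forall>\<beta> \<in> \<D>. cmod \<beta> \<le> cmod \<alpha>}"
      using D[OF \<alpha>] region_D_cmod_le by simp
  qed
qed

lemma minimal_points:
  "{\<alpha> \<in> frontier \<D>. \<forall>\<beta> \<in> frontier \<D>. cmod \<alpha> \<le> cmod \<beta>} = alpha_min ` {1..6}"
  unfolding alpha_min_image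
proof (intro equalityI subsetI)
  fix \<alpha>
  assume "\<alpha> \<in> {\<alpha> \<in> frontier \<D>. \<forall>\<beta> \<in> frontier \<D>. cmod \<alpha> \<le> cmod \<beta>}"
  \<comment> \<open>The point 1 is a sixth root of unity, hence a frontier point to compare
    with.\<close>
  then have \<alpha>: "\<alpha> \<in> frontier \<D>" "cmod \<alpha> \<le> cmod 1"
    using frontier_region_D_root_of_unity(1)[of 1] by (blast, metis (no_types, lifting) mem_Collect_eq power_one)
  then have "cmod \<alpha> = 1"
    using frontier_region_D_cmod(1)[of \<alpha>] by simp
  then show "\<alpha> \<in> {z. z ^ 6 = 1}"
    using frontier_region_D_cmod(2) \<alpha>(1) by blast
next
  fix \<alpha> :: complex
  assume "\<alpha> \<in> {z. z ^ 6 = 1}"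
  then have "\<alpha> ^ 6 = 1" ..
  then show "\<alpha> \<in> {\<alpha> \<in> frontier \<D>. \<forall>\<beta> \<in> frontier \<D>. cmod \<alpha> \<le> cmod \<beta>}"
    using frontier_region_D_root_of_unity frontier_region_D_cmod(1) by simp
qed

lemma X6_equiv_C6_at_alpha_max:
  assumes "k \<in> {1..6}" "admissible (alpha_max k) x y u v"
  shows "hadamard_equiv (X6 x y u v) C6"
proof -
  define S where "S = sqrt (- 9 + 6 * sqrt 3)"
  have "alpha_max k \<in> {z. z ^ 6 = (\<i> * of_real S) ^ 6}"
    using assms(1) unfolding S_def alpha_max_image[symmetric] by blast
  then have 6: "alpha_max k ^ 6 = (\<i> * of_real S) ^ 6" ..
  have "\<i> * of_real S \<noteq> 0"
    using sqrt3_ge by (simp add: S_def)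
  with assms(2) 6 obtain \<beta> x' y' z' u' v' w' where \<beta>: "\<beta> \<in> {\<i> * of_real S, - (\<i> * of_real S)}"
    and X6: "X6 x y u v = X6 x' y' u' v'"
    and p: "proots (f_poly \<beta>) = {#x', y', z'#}" "proots (f_poly (- \<beta>)) = {#u', v', w'#}"
    by (rule admissible_reduce)
  have iS: "\<i> * of_real S = d6\<^sup>2 - 2 * cnj d6"
    unfolding S_def by (rule imag_sqrt_d6)
  have plus: "proots (f_poly (\<i> * of_real S)) = {#d6\<^sup>2, - cnj d6, - cnj d6#}"
    unfolding proots_f_poly_iff iS by (simp add: d6_cnj power2_eq_square algebra_simps)
  \<comment> \<open>The root sum agrees because \<open>d6_quadratic\<close> says
    \<open>(cnj d6)\<^sup>2 - 2 * d6 = - (d6\<^sup>2 - 2 * cnj d6)\<close>.\<close>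
  have minus: "proots (f_poly (- (\<i> * of_real S))) = {#(cnj d6)\<^sup>2, - d6, - d6#}"
    using d6_quadratic unfolding proots_f_poly_iff iS
    by (simp add: d6_cnj power2_eq_square algebra_simps)
  have one: "d6\<^sup>2 * - cnj d6 * - cnj d6 = 1" "(cnj d6)\<^sup>2 * - d6 * - d6 = 1"
    by (simp_all add: d6_cnj power2_eq_square mult_ac)
  show ?thesis
  proof (cases "\<beta> = \<i> * of_real S")
    case True
    then have xyz: "{#x', y', z'#} = {#d6\<^sup>2, - cnj d6, - cnj d6#}"
      and uvw: "{#u', v', w'#} = {#(cnj d6)\<^sup>2, - d6, - d6#}"
      using p plus minus by simp_all
    have K: "hadamard_equiv (X6 x' y' ((cnj d6)\<^sup>2) (- d6)) C6"
      using add_mset_triple_cases[OF xyz]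
      by (elim insertE emptyE) (simp_all only: prod.inject X6_equiv_C6)
    \<comment> \<open>As \<open>- d6\<close> is a double root, the same pair represents both cyclic
      classes, so \<open>K\<close> serves twice.\<close>
    show ?thesis
      unfolding X6 by (rule X6_permute[OF uvw one(2) K K])
  next
    case False
    then have "\<beta> = - (\<i> * of_real S)"
      using \<beta> by blast
    then have xyz: "{#x', y', z'#} = {#(cnj d6)\<^sup>2, - d6, - d6#}"
      and uvw: "{#u', v', w'#} = {#d6\<^sup>2, - cnj d6, - cnj d6#}"
      using p plus minus by simp_all
    have K: "hadamard_equiv (X6 x' y' (d6\<^sup>2) (- cnj d6)) C6"
      using add_mset_triple_cases[OF xyz]
      by (elim insertE emptyE) (simp_all only: prod.inject X6_equiv_C6)
    show ?thesis
      unfolding X6 by (rule X6_permute[OF uvw one(1) K K])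
  qed
qed

lemma X6_equiv_D6_at_alpha_min:
  assumes "k \<in> {1..6}" "admissible (alpha_min k) x y u v"
  shows "hadamard_equiv (X6 x y u v) D6"
proof -
  have "alpha_min k \<in> {z. z ^ 6 = 1}"
    using assms(1) unfolding alpha_min_image[symmetric] by blast
  then have "alpha_min k ^ 6 = 1 ^ 6"
    by simp
  with assms(2) obtain \<beta> x' y' z' u' v' w' where \<beta>: "\<beta> \<in> {1, - 1}"
    and X6: "X6 x y u v = X6 x' y' u' v'"
    and p: "proots (f_poly \<beta>) = {#x', y', z'#}" "proots (f_poly (- \<beta>)) = {#u', v', w'#}"
    by (rule admissible_reduce) simp
  have plus: "proots (f_poly 1) = {#1, \<i>, - \<i>#}"
    unfolding proots_f_poly_iff by simp
  have minus: "proots (f_poly (- 1)) = {#1, - 1, - 1#}"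
    unfolding proots_f_poly_iff by simp
  show ?thesis
  proof (cases "\<beta> = 1")
    case True
    then have xyz: "{#x', y', z'#} = {#1, \<i>, - \<i>#}" and uvw: "{#u', v', w'#} = {#1, - 1, - 1#}"
      using p plus minus by simp_all
    have K: "hadamard_equiv (X6 x' y' 1 (- 1)) D6"
      using add_mset_triple_cases[OF xyz]
      by (elim insertE emptyE) (simp_all only: prod.inject X6_equiv_D6)
    show ?thesis
      unfolding X6 by (rule X6_permute[OF uvw _ K K]) simp
  next
    case False
    then have "\<beta> = - 1"
      using \<beta> by blast
    then have xyz: "{#x', y', z'#} = {#1, - 1, - 1#}" and uvw: "{#u', v', w'#} = {#1, \<i>, - \<i>#}"
      using p plus minus by simp_all
    \<comment> \<open>The roots 1, \<i>, -\<i> are distinct, so their two cyclic classes need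
      separate equivalences.\<close>
    have K1: "hadamard_equiv (X6 x' y' 1 \<i>) D6"
      using add_mset_triple_cases[OF xyz]
      by (elim insertE emptyE) (simp_all only: prod.inject X6_equiv_D6)
    have K2: "hadamard_equiv (X6 x' y' 1 (- \<i>)) D6"
      using add_mset_triple_cases[OF xyz]
      by (elim insertE emptyE) (simp_all only: prod.inject X6_equiv_D6)
    show ?thesis
      unfolding X6 by (rule X6_permute[OF uvw _ K1 K2]) simp
  qed
qed

theorem lemma3p2:
  shows "({\<alpha> \<in> \<D>. \<forall>\<beta> \<in> \<D>. cmod \<beta> \<le> cmod \<alpha>} = alpha_max ` {1..6} \<and>
          card (alpha_max ` {1..6}) = 6 \<and>
          (\<forall>k \<in> {1..6}. \<forall>x y u v. admissible (alpha_max k) x y u v \<longrightarrow>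
             hadamard_equiv (X6 x y u v) C6)) \<and>
         ({\<alpha> \<in> frontier \<D>. \<forall>\<beta> \<in> frontier \<D>. cmod \<alpha> \<le> cmod \<beta>} = alpha_min ` {1..6} \<and>
          card (alpha_min ` {1..6}) = 6 \<and>
          (\<forall>k \<in> {1..6}. \<forall>x y u v. admissible (alpha_min k) x y u v \<longrightarrow>
             hadamard_equiv (X6 x y u v) D6))"
proof (intro conjI ballI allI impI)
  have "(\<i> * complex_of_real (sqrt (- 9 + 6 * sqrt 3))) ^ 6 \<noteq> 0"
    using sqrt3_ge by simp
  then show "card (alpha_max ` {1..6}) = 6"
    unfolding alpha_max_image by (rule card_sixth_roots)
  show "card (alpha_min ` {1..6}) = 6"
    unfolding alpha_min_image by (rule card_sixth_roots) simp
qed (fact maximal_points minimal_points | erule (1) X6_equiv_C6_at_alpha_max X6_equiv_D6_at_alpha_min)+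

end
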